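(* Let $X$ be an Archimedean pervasive pre-Riesz space, with Dedekind completion $X^\delta$ and embedding $i\colon X\to X^\delta$. Let $B$ be a band in $X$, let $\hat{B}$ be the smallest extension band of $B$ in $X^\delta$, and let $i(B)$ be majorizing in $\hat{B}$. Then $(\hat{B},i|_{B})$ is the Dedekind completion of $B$, and $B$ is pervasive.
   Context: All ordered vector spaces are real vector spaces with a partial order given by a cone $X_+$ ($x\le y$ iff $y-x\in X_+$); linear subspaces carry the induced order. $X$ is Archimedean if $nx\le y$ for all $n\in\mathbb{N}$ implies $x\le 0$. A linear subspace $D$ of an ordered vector space $Z$ is majorizing in $Z$ if every $z\in Z$ satisfies $z\le d$ for some $d\in D$, and order dense in $Z$ if for every $z\in Z$ one has $z=\inf\{d\in D: z\le d\}$ (infimum in $Z$). A linear map $i$ is bipositive if $i(x)\ge 0\iff x\ge 0$. An ordered vector space $X$ is pre-Riesz if there are a vector lattice $Y$ and a bipositive linear map $i\colon X\to Y$ with $i(X)$ order dense in $Y$; then $(Y,i)$ is called a vector lattice cover of $X$. A pre-Riesz space $X$ is pervasive if for a vector lattice cover $(Y,i)$ (equivalently, for every vector lattice cover) and every $y\in Y_+$, $y\ne 0$, there is $x\in X$ with $0<i(x)\le y$. The Dedekind completion of an Archimedean directed ordered vector space $X$ is the (unique up to isomorphism) vector lattice cover $(X^\delta,i)$ of $X$ with $X^\delta$ Dedekind complete (every non-empty subset bounded above has a supremum). For $M\subseteq X$ let $M^u$ be the set of upper bounds of $M$ in $X$. Elements $x,y\in X$ are disjoint, $x\perp y$, if $\{x+y,-(x+y)\}^u=\{x-y,-(x-y)\}^u$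 (in a vector lattice this is the usual disjointness). For $M\subseteq X$, $M^{\mathrm d}=\{x\in X: x\perp y\text{ for all }y\in M\}$ and $M^{\mathrm{dd}}=(M^{\mathrm d})^{\mathrm d}$. A band is a linear subspace $B$ with $B=B^{\mathrm{dd}}$. A band $J$ of $X^\delta$ is an extension band of a band $B$ of $X$ if $B=\{x\in X: i(x)\in J\}$. Every band of $X$ has an extension band, and the intersection $\hat B$ of all its extension bands is the smallest extension band. *)

theory Defs
  imports Complex_Main "HOL-Library.Lub_Glb"
begin

text \<open>
  Ambient ordered vector spaces are types of class \<^class>\<open>ordered_real_vector\<close>. A linear subspace
  with the induced order is a set \<open>D\<close> with \<^term>\<open>subspace D\<close>, so the notions for ordered vector
  spaces that are also needed for subspaces (bands) take a carrier set; bounds, suprema and infima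
  are then taken inside that carrier. A map out of \<open>D\<close> is a function on the whole type of
  which only the values on \<open>D\<close> matter; hence a map \<open>i\<close> also serves as its own restriction to \<open>D\<close>.
\<close>

text \<open>Including \<open>n = 0\<close> is harmless: if \<open>n x \<le> y\<close> for all \<open>n \<ge> 1\<close>, then \<open>n x \<le> y - x\<close> for all \<open>n \<ge> 0\<close>.\<close>

definition archimedean_on :: "'a::ordered_real_vector set \<Rightarrow> bool" where
  "archimedean_on D \<longleftrightarrow>
     (\<forall>x\<in>D. \<forall>y\<in>D. (\<forall>n::nat. real n *\<^sub>R x \<le> y) \<longrightarrow> x \<le> 0)"

definition directed_on :: "'a::ordered_real_vector set \<Rightarrow> bool" where
  "directed_on D \<longleftrightarrow> (\<forall>x\<in>D. \<forall>y\<in>D. \<exists>z\<in>D. x \<le> z \<and> y \<le> z)"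

definition majorizing_in :: "'a::ordered_real_vector set \<Rightarrow> 'a set \<Rightarrow> bool" where
  "majorizing_in D Z \<longleftrightarrow> subspace D \<and> D \<subseteq> Z \<and> (\<forall>z\<in>Z. \<exists>d\<in>D. z \<le> d)"

definition order_dense_in :: "'a::ordered_real_vector set \<Rightarrow> 'a set \<Rightarrow> bool" where
  "order_dense_in D Z \<longleftrightarrow> subspace D \<and> D \<subseteq> Z \<and> (\<forall>z\<in>Z. isGlb Z {d\<in>D. z \<le> d} z)"

definition vector_lattice_on :: "'a::ordered_real_vector set \<Rightarrow> bool" where
  "vector_lattice_on E \<longleftrightarrow> subspace E \<and>
     (\<forall>x\<in>E. \<forall>y\<in>E. (\<exists>s. isLub E {x, y} s) \<and> (\<exists>t. isGlb E {x, y} t))"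

definition dedekind_complete_on :: "'a::ordered_real_vector set \<Rightarrow> bool" where
  "dedekind_complete_on E \<longleftrightarrow>
     (\<forall>S\<subseteq>E. S \<noteq> {} \<longrightarrow> (\<exists>u. isUb E S u) \<longrightarrow> (\<exists>s. isLub E S s))"

definition linear_on_subspace ::
  "'a::real_vector set \<Rightarrow> ('a \<Rightarrow> 'b::real_vector) \<Rightarrow> bool" where
  "linear_on_subspace D i \<longleftrightarrow>
     (\<forall>x\<in>D. \<forall>y\<in>D. i (x + y) = i x + i y) \<and> (\<forall>c. \<forall>x\<in>D. i (c *\<^sub>R x) = c *\<^sub>R i x)"

definition bipositive_on ::
  "'a::ordered_real_vector set \<Rightarrow> ('a \<Rightarrow> 'b::ordered_real_vector) \<Rightarrow> bool" where
  "bipositive_on D i \<longleftrightarrow> (\<forall>x\<in>D. 0 \<le> i x \<longleftrightarrow> 0 \<le> x)"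

text \<open>\<open>(E, i)\<close> is a vector lattice cover of \<open>D\<close>; in particular \<open>D\<close> is pre-Riesz.\<close>

definition vector_lattice_cover ::
  "'a::ordered_real_vector set \<Rightarrow> 'b::ordered_real_vector set \<Rightarrow> ('a \<Rightarrow> 'b) \<Rightarrow> bool" where
  "vector_lattice_cover D E i \<longleftrightarrow>
     subspace D \<and> vector_lattice_on E \<and> linear_on_subspace D i \<and> bipositive_on D i \<and>
     order_dense_in (i ` D) E"

text \<open>
  HOL cannot quantify over the types in which covers live, so pervasiveness of \<open>D\<close> is expressed
  relative to a cover: \<open>D\<close> is a pervasive pre-Riesz space iff \<open>pervasive_wrt D E i\<close> holds for
  a vector lattice cover \<open>(E, i)\<close> of \<open>D\<close>, in any type.
\<close>

definition pervasive_wrt ::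
  "'a::ordered_real_vector set \<Rightarrow> 'b::ordered_real_vector set \<Rightarrow> ('a \<Rightarrow> 'b) \<Rightarrow> bool" where
  "pervasive_wrt D E i \<longleftrightarrow> vector_lattice_cover D E i \<and>
     (\<forall>y\<in>E. 0 \<le> y \<and> y \<noteq> 0 \<longrightarrow> (\<exists>x\<in>D. 0 < i x \<and> i x \<le> y))"

definition dedekind_completion ::
  "'a::ordered_real_vector set \<Rightarrow> 'b::ordered_real_vector set \<Rightarrow> ('a \<Rightarrow> 'b) \<Rightarrow> bool" where
  "dedekind_completion D E i \<longleftrightarrow>
     archimedean_on D \<and> directed_on D \<and> vector_lattice_cover D E i \<and> dedekind_complete_on E"

definition disjoint_elems :: "'a::ordered_real_vector \<Rightarrow> 'a \<Rightarrow> bool" (infix "\<bottom>\<^sub>o" 50) where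
  "x \<bottom>\<^sub>o y \<longleftrightarrow> ubs UNIV {x + y, - (x + y)} = ubs UNIV {x - y, - (x - y)}"

definition disjoint_compl :: "'a::ordered_real_vector set \<Rightarrow> 'a set" where
  "disjoint_compl M = {x. \<forall>y\<in>M. x \<bottom>\<^sub>o y}"

definition band :: "'a::ordered_real_vector set \<Rightarrow> bool" where
  "band B \<longleftrightarrow> subspace B \<and> B = disjoint_compl (disjoint_compl B)"

definition extension_band ::
  "('a::ordered_real_vector \<Rightarrow> 'b::ordered_real_vector) \<Rightarrow> 'a set \<Rightarrow> 'b set \<Rightarrow> bool" where
  "extension_band i B J \<longleftrightarrow> band J \<and> B = {x. i x \<in> J}"

definition smallest_extension_band ::
  "('a::ordered_real_vector \<Rightarrow> 'b::ordered_real_vector) \<Rightarrow> 'a set \<Rightarrow> 'b set" where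
  "smallest_extension_band i B = \<Inter> {J. extension_band i B J}"

end

theory Submission
  imports Defs "HOL-Library.Lattice_Algebras"
begin

text \<open>
  Pervasiveness has a formulation that does not mention a cover: every \<open>b\<close> with \<open>b \<le> 0\<close> false
  admits some \<open>x > 0\<close> below all common upper bounds of \<open>0\<close> and \<open>b\<close>. Hence it passes from one
  vector lattice cover to any other. Next, \<open>i\<close> preserves and reflects disjointness, so
  \<open>i(B)\<^sup>d\<^sup>d\<close> is the smallest extension band; being a band of a vector lattice, it is a directed
  order convex subspace. The point is order density of \<open>i(B)\<close> in it. If \<open>w\<close> is a lower bound
  of \<open>{i d | d \<in> B, z \<le> i d}\<close> and \<open>s = w \<squnion> z\<close> exceeds \<open>z\<close>, pervasiveness gives \<open>0 < i x \<le> s - z\<close>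
  with \<open>x \<in> B\<close>. Then \<open>z \<le> i d\<close> implies \<open>z \<le> i (d - x)\<close>, and by iteration \<open>z \<le> i (d - n x)\<close> for
  all \<open>n\<close>, contradicting the Archimedean property.
\<close>

section \<open>Bounds and covers\<close>

lemma isLub_iff:
  "isLub R S x \<longleftrightarrow> x \<in> R \<and> (\<forall>s\<in>S. s \<le> x) \<and> (\<forall>w\<in>R. (\<forall>s\<in>S. s \<le> w) \<longrightarrow> x \<le> w)"
  by (auto simp: isLub_def leastP_def isUb_def setle_def setge_def)

lemma isGlb_iff:
  "isGlb R S x \<longleftrightarrow> x \<in> R \<and> (\<forall>s\<in>S. x \<le> s) \<and> (\<forall>w\<in>R. (\<forall>s\<in>S. w \<le> s) \<longrightarrow> w \<le> x)"
  by (auto simp: isGlb_def greatestP_def isLb_def setle_def setge_def)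

lemma ubs_UNIV_iff: "u \<in> ubs UNIV S \<longleftrightarrow> (\<forall>s\<in>S. s \<le> u)"
  by (auto simp: ubs_def isUb_def setle_def)

locale lattice_cover =
  fixes D :: "'a::ordered_real_vector set" and E :: "'b::ordered_real_vector set"
    and i :: "'a \<Rightarrow> 'b"
  assumes cover: "vector_lattice_cover D E i"
begin

lemma subspace_D: "subspace D"
  and subspace_E: "subspace E"
  using cover by (auto simp: vector_lattice_cover_def vector_lattice_on_def)

lemma image_in_E: "x \<in> D \<Longrightarrow> i x \<in> E"
  using cover by (auto simp: vector_lattice_cover_def order_dense_in_def)

lemma map_add: "x \<in> D \<Longrightarrow> y \<in> D \<Longrightarrow> i (x + y) = i x + i y"
  and map_scaleR: "x \<in> D \<Longrightarrow> i (c *\<^sub>R x) = c *\<^sub>R i x"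
  using cover by (auto simp: vector_lattice_cover_def linear_on_subspace_def)

lemma map_minus: "x \<in> D \<Longrightarrow> i (- x) = - i x"
  using map_scaleR[of x "-1"] by simp

lemma map_diff: "x \<in> D \<Longrightarrow> y \<in> D \<Longrightarrow> i (x - y) = i x - i y"
  using map_add[of x "- y"] map_minus[of y] subspace_neg[OF subspace_D] by simp

lemma map_zero: "i 0 = 0"
  using map_scaleR[of 0 0] subspace_0[OF subspace_D] by simp

lemma map_le_iff: "x \<in> D \<Longrightarrow> y \<in> D \<Longrightarrow> i x \<le> i y \<longleftrightarrow> x \<le> y"
  using cover map_diff[of y x] subspace_diff[OF subspace_D, of y x]
  by (auto simp: vector_lattice_cover_def bipositive_on_def)

lemma map_pos_iff: "x \<in> D \<Longrightarrow> 0 < i x \<longleftrightarrow> 0 < x"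
  using map_le_iff[of 0 x] map_le_iff[of x 0] subspace_0[OF subspace_D]
  by (auto simp: map_zero less_le_not_le)

text \<open>Order density as it is used here: an inequality in the cover can be tested against
  majorants coming from \<open>D\<close> alone.\<close>

lemma le_if_le_majorants:
  assumes "z \<in> E" "w \<in> E" "\<And>d. d \<in> D \<Longrightarrow> z \<le> i d \<Longrightarrow> w \<le> i d"
  shows "w \<le> z"
proof -
  have "isGlb E {d \<in> i ` D. z \<le> d} z"
    using cover assms(1) by (simp add: vector_lattice_cover_def order_dense_in_def)
  then show ?thesis using assms(2,3) by (auto simp: isGlb_iff)
qed

text \<open>The right-hand side involves only \<open>D\<close>, which makes covers comparable. The
  supremum of \<open>0\<close> and \<open>i b\<close> links both sides: from left to right
  pervasiveness is applied to it, and on the right the common upper bounds of \<open>0\<close> and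
  \<open>b\<close> in \<open>D\<close> stand in for it.\<close>

lemma pervasive_wrt_iff:
  "pervasive_wrt D E i \<longleftrightarrow>
     (\<forall>b\<in>D. \<not> b \<le> 0 \<longrightarrow> (\<exists>x\<in>D. 0 < x \<and> (\<forall>u\<in>D. 0 \<le> u \<and> b \<le> u \<longrightarrow> x \<le> u)))"
  (is "_ \<longleftrightarrow> (\<forall>b\<in>D. \<not> b \<le> 0 \<longrightarrow> ?P b)")
proof (intro iffI ballI impI)
  fix b assume perv: "pervasive_wrt D E i" and b: "b \<in> D" "\<not> b \<le> 0"
  have "0 \<in> E" "i b \<in> E" using b subspace_0[OF subspace_E] image_in_E by auto
  then obtain s where s: "isLub E {0, i b} s"
    using cover by (auto simp: vector_lattice_cover_def vector_lattice_on_def)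
  have "\<not> i b \<le> 0"
    using b map_le_iff[of b 0] subspace_0[OF subspace_D] by (simp add: map_zero)
  with s have "s \<in> E" "0 \<le> s" "s \<noteq> 0" by (auto simp: isLub_iff)
  with perv obtain x where x: "x \<in> D" "0 < i x" "i x \<le> s"
    unfolding pervasive_wrt_def by blast
  have "x \<le> u" if u: "u \<in> D" "0 \<le> u" "b \<le> u" for u
  proof -
    have "0 \<le> i u" "i b \<le> i u"
      using u b map_le_iff[of 0 u] map_le_iff[of b u] subspace_0[OF subspace_D]
      by (auto simp: map_zero)
    then have "s \<le> i u" using s image_in_E[OF u(1)] by (auto simp: isLub_iff)
    then show ?thesis using x u map_le_iff by (meson order_trans)
  qed
  then show "?P b" using x map_pos_iff by blast
next
  assume *: "\<forall>b\<in>D. \<not> b \<le> 0 \<longrightarrow> ?P b"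
  have "\<exists>x\<in>D. 0 < i x \<and> i x \<le> y" if y: "y \<in> E" "0 \<le> y" "y \<noteq> 0" for y
  proof -
    \<comment> \<open>If every element of \<open>D\<close> mapped below \<open>y\<close> were \<le>
      0, every majorant \<open>i d\<close> of \<open>- y\<close> would be positive. Order density
      then yields \<open>0 \<le> - y\<close>, contrary to \<open>y\<close> being positive and
      nonzero.\<close>
    have "\<exists>b\<in>D. i b \<le> y \<and> \<not> b \<le> 0"
    proof (rule ccontr)
      assume no: "\<not> ?thesis"
      have "0 \<le> - y"
      proof (rule le_if_le_majorants)
        show "- y \<in> E" "0 \<in> E" using y subspace_E by (auto simp: subspace_neg subspace_0)
        fix d assume d: "d \<in> D" "- y \<le> i d"
        then have "- d \<in> D" "i (- d) \<le> y"
          using subspace_neg[OF subspace_D] by (auto simp: map_minus minus_le_iff)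
        then have "- d \<le> 0" using no by blast
        then show "0 \<le> i d"
          using d map_le_iff[of 0 d] subspace_0[OF subspace_D] by (simp add: map_zero)
      qed
      then show False using y by simp
    qed
    then obtain b where b: "b \<in> D" "i b \<le> y" "\<not> b \<le> 0" by blast
    then obtain x where x: "x \<in> D" "0 < x" "\<And>u. u \<in> D \<Longrightarrow> 0 \<le> u \<Longrightarrow> b \<le> u \<Longrightarrow> x \<le> u"
      using *[rule_format, OF b(1,3)] by auto
    \<comment> \<open>A majorant \<open>i d\<close> of \<open>y\<close> lies above both
      \<open>0\<close> and \<open>i b\<close>, so the choice of \<open>x\<close> applies to
      \<open>d\<close>.\<close>
    have "i x \<le> y"
    proof (rule le_if_le_majorants[OF y(1) image_in_E[OF x(1)]])
      fix d assume d: "d \<in> D" "y \<le> i d"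
      then have "i 0 \<le> i d" "i b \<le> i d" using y b by (auto simp: map_zero)
      then have "x \<le> d" using x d b map_le_iff subspace_0[OF subspace_D] by blast
      then show "i x \<le> i d" using map_le_iff x d by blast
    qed
    then show ?thesis using x map_pos_iff by blast
  qed
  then show "pervasive_wrt D E i" using cover unfolding pervasive_wrt_def by blast
qed

end

lemma pervasive_wrt_cover_indep:
  assumes "pervasive_wrt D E i" "vector_lattice_cover D Z k"
  shows "pervasive_wrt D Z k"
proof -
  interpret E: lattice_cover D E i
    using assms(1) by unfold_locales (simp add: pervasive_wrt_def)
  interpret Z: lattice_cover D Z k
    using assms(2) by unfold_locales
  show ?thesis using assms(1) by (simp only: E.pervasive_wrt_iff Z.pervasive_wrt_iff)
qed

section \<open>Disjointness\<close>

lemma disjoint_elems_commute: "x \<bottom>\<^sub>o y \<longleftrightarrow> y \<bottom>\<^sub>o x"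
  by (simp add: disjoint_elems_def add.commute insert_commute)

lemma disjoint_compl_antimono: "M \<subseteq> N \<Longrightarrow> disjoint_compl N \<subseteq> disjoint_compl M"
  by (auto simp: disjoint_compl_def)

lemma subset_disjoint_compl_twice: "M \<subseteq> disjoint_compl (disjoint_compl M)"
  using disjoint_elems_commute by (auto simp: disjoint_compl_def)

lemma disjoint_compl_thrice: "disjoint_compl (disjoint_compl (disjoint_compl M)) = disjoint_compl M"
  by (intro equalityI disjoint_compl_antimono subset_disjoint_compl_twice)

text \<open>The operations are parameters because a vector lattice is given only by the existence of
  suprema and infima of pairs; they are chosen in \<open>vector_lattice_on_UNIV_obtains\<close>. The
  sublocale then supplies the calculus of lattice-ordered groups.\<close>

locale real_vector_lattice =
  fixes meet :: "'a::ordered_real_vector \<Rightarrow> 'a \<Rightarrow> 'a" (infixl "\<sqinter>" 70)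
    and join :: "'a \<Rightarrow> 'a \<Rightarrow> 'a" (infixl "\<squnion>" 65)
  assumes lattice: "class.lattice meet (\<le>) (<) join"
begin

sublocale lattice_ab_group_add "(+)" 0 "(-)" uminus "(\<le>)" "(<)" meet join
proof -
  interpret lattice meet "(\<le>)" "(<)" join by (rule lattice)
  show "class.lattice_ab_group_add (+) 0 (-) uminus (\<le>) (<) meet join" ..
qed

section \<open>Modulus and disjointness in a vector lattice\<close>

definition modulus :: "'a \<Rightarrow> 'a" where
  "modulus x = x \<squnion> - x"

lemma le_modulus: "x \<le> modulus x"
  and neg_le_modulus: "- x \<le> modulus x"
  by (simp_all add: modulus_def)

lemma modulus_le_iff: "modulus x \<le> u \<longleftrightarrow> x \<le> u \<and> - x \<le> u"
  by (simp add: modulus_def)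

lemma modulus_nonneg: "0 \<le> modulus x"
proof -
  have "x + - x \<le> modulus x + modulus x"
    by (intro add_mono le_modulus neg_le_modulus)
  then show ?thesis by simp
qed

lemma modulus_of_nonneg: "0 \<le> x \<Longrightarrow> modulus x = x"
  by (intro order.antisym) (auto simp: modulus_le_iff le_modulus intro: order_trans[of "- x" 0 x])

lemma modulus_scaleR_le: "modulus (c *\<^sub>R x) \<le> \<bar>c\<bar> *\<^sub>R modulus x"
proof (cases "c \<ge> 0")
  case True
  then show ?thesis
    using scaleR_left_mono[OF le_modulus, of c x] scaleR_left_mono[OF neg_le_modulus, of c x]
    by (simp add: modulus_le_iff)
next
  case False
  then show ?thesis
    using scaleR_left_mono[OF le_modulus, of "- c" x]
      scaleR_left_mono[OF neg_le_modulus, of "- c" x]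
    by (simp add: modulus_le_iff)
qed

lemma modulus_add_le: "modulus (x + y) \<le> modulus x + modulus y"
  using add_mono[OF le_modulus[of x] le_modulus[of y]]
    add_mono[OF neg_le_modulus[of x] neg_le_modulus[of y]]
  by (simp add: modulus_le_iff)

text \<open>A fragment of distributivity obtained by translation: with
  \<open>q = r \<sqinter> a\<close>, the element \<open>r - q\<close> turns out to be an upper bound
  of \<open>b\<close> and \<open>c\<close>, hence of their join \<open>r\<close>.\<close>

lemma join_meet_nonpos_iff: "(b \<squnion> c) \<sqinter> a \<le> 0 \<longleftrightarrow> b \<sqinter> a \<le> 0 \<and> c \<sqinter> a \<le> 0"
proof
  assume "(b \<squnion> c) \<sqinter> a \<le> 0"
  moreover have "b \<sqinter> a \<le> (b \<squnion> c) \<sqinter> a" "c \<sqinter> a \<le> (b \<squnion> c) \<sqinter> a"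
    by (rule inf_mono; simp)+
  ultimately show "b \<sqinter> a \<le> 0 \<and> c \<sqinter> a \<le> 0" by (meson order_trans)
next
  define r where "r = b \<squnion> c"
  define q where "q = r \<sqinter> a"
  assume *: "b \<sqinter> a \<le> 0 \<and> c \<sqinter> a \<le> 0"
  have "d \<le> r - q" if d: "d \<le> r" "d \<sqinter> a \<le> 0" for d
  proof -
    \<comment> \<open>The translate of \<open>q\<close> by \<open>d - r\<close> \<le> 0 lies below
      both \<open>d\<close> and \<open>a\<close>.\<close>
    have "q + (d - r) \<le> r + (d - r)" "q + (d - r) \<le> a + 0"
      using d(1) by (intro add_mono; simp add: q_def)+
    then have "q + (d - r) \<le> d \<sqinter> a" by simp
    then have "q + (d - r) \<le> 0" using d(2) by (rule order_trans)
    then show ?thesis by (simp add: algebra_simps)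
  qed
  from this[of b] this[of c] have "r \<le> r - q" using * by (simp add: r_def)
  then have "q \<le> 0" by simp
  then show "(b \<squnion> c) \<sqinter> a \<le> 0" by (simp only: q_def r_def)
qed

text \<open>Writing \<open>a - b\<close> as \<open>a + b - (b + b)\<close> and \<open>b - a\<close>
  as \<open>a + b - (a + a)\<close> expresses the modulus as \<open>a + b\<close> minus the meet of
  the doubles, so only the sign of that meet matters.\<close>

lemma add_le_modulus_diff_iff: "a + b \<le> modulus (a - b) \<longleftrightarrow> a \<sqinter> b \<le> 0"
proof -
  have "modulus (a - b) = (a + b - (b + b)) \<squnion> (a + b - (a + a))"
    by (simp add: modulus_def)
  also have "\<dots> = a + b - (b + b) \<sqinter> (a + a)"
    by (simp only: neg_inf_eq_sup add_sup_distrib_left flip: add_uminus_conv_diff)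
  finally have "modulus (a - b) = a + b - (b + b) \<sqinter> (a + a)" .
  then have "a + b \<le> modulus (a - b) \<longleftrightarrow> (a + a) \<sqinter> (b + b) \<le> 0"
    by (simp only: le_diff_eq add_le_same_cancel1 inf_commute)
  also have "\<dots> \<longleftrightarrow> a \<sqinter> b \<le> 0"
  proof
    assume *: "(a + a) \<sqinter> (b + b) \<le> 0"
    have "a \<sqinter> b + a \<sqinter> b \<le> (a + a) \<sqinter> (b + b)"
      by (simp add: add_mono)
    then show "a \<sqinter> b \<le> 0" using * by (metis order_trans double_add_le_zero_iff_single_add_le_zero)
  next
    assume *: "a \<sqinter> b \<le> 0"
    \<comment> \<open>Half of \<open>p\<close> lies below \<open>a\<close> and \<open>b\<close>,
      hence below their meet.\<close>
    define p where "p = (a + a) \<sqinter> (b + b)"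
    have "(1/2) *\<^sub>R p \<le> (1/2) *\<^sub>R (a + a)" "(1/2) *\<^sub>R p \<le> (1/2) *\<^sub>R (b + b)"
      by (intro scaleR_left_mono; simp add: p_def)+
    then have "(1/2) *\<^sub>R p \<le> a \<sqinter> b" by (simp flip: scaleR_2)
    then have "(1/2) *\<^sub>R p \<le> 0" using * by (rule order_trans)
    then have "2 *\<^sub>R (1/2) *\<^sub>R p \<le> 2 *\<^sub>R 0" by (rule scaleR_left_mono) simp
    then have "p \<le> 0" by simp
    then show "(a + a) \<sqinter> (b + b) \<le> 0" by (simp only: p_def)
  qed
  finally show ?thesis .
qed

text \<open>The upper bounds of \<open>a\<close> and \<open>- a\<close> are those of
  \<open>modulus a\<close>, so disjointness says that \<open>x + y\<close> and \<open>x - y\<close>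
  have equal moduli. Since moduli are nonnegative, \<le> 0 amounts to the usual condition that their
  meet is zero.\<close>

lemma disjoint_elems_iff: "x \<bottom>\<^sub>o y \<longleftrightarrow> modulus x \<sqinter> modulus y \<le> 0"
proof -
  have "ubs UNIV {a, - a} = {modulus a..}" for a
    by (auto simp: ubs_UNIV_iff modulus_le_iff)
  from this[of "x + y"] this[of "x - y"]
  have "x \<bottom>\<^sub>o y \<longleftrightarrow> modulus (x + y) = modulus (x - y)"
    by (simp add: disjoint_elems_def)
  also have "\<dots> \<longleftrightarrow> x \<sqinter> y \<le> 0 \<and> (- x) \<sqinter> (- y) \<le> 0 \<and> x \<sqinter> (- y) \<le> 0 \<and> (- x) \<sqinter> y \<le> 0"
  proof -
    have neg: "modulus (- a) = modulus a" for a by (simp add: modulus_def sup_commute)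
    \<comment> \<open>The two instances \<open>(x, y)\<close> and \<open>(x, - y)\<close> give the
      two inequalities that make up the equality of moduli.\<close>
    have "modulus (a + b) \<le> modulus (a - b) \<longleftrightarrow> a \<sqinter> b \<le> 0 \<and> (- a) \<sqinter> (- b) \<le> 0" for a b
      using add_le_modulus_diff_iff[of a b] add_le_modulus_diff_iff[of "- a" "- b"] neg[of "a - b"]
      by (simp only: modulus_le_iff minus_add_distrib minus_diff_eq minus_minus add_uminus_conv_diff
          diff_minus_eq_add add.commute[of "- a" b])
    from this[of x y] this[of x "- y"] show ?thesis
      by (simp only: order.eq_iff[of "modulus _"] minus_minus add_uminus_conv_diff diff_minus_eq_add conj_assoc)
  qed
  also have "\<dots> \<longleftrightarrow> modulus x \<sqinter> modulus y \<le> 0"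
    using join_meet_nonpos_iff[of x "- x" "modulus y"] join_meet_nonpos_iff[of y "- y" x]
      join_meet_nonpos_iff[of y "- y" "- x"]
    by (auto simp: modulus_def inf_commute simp del: neg_sup_eq_inf neg_inf_eq_sup)
  finally show ?thesis .
qed

text \<open>With the meet eliminated, the closure properties below become plain estimates of
  moduli.\<close>

lemma disjoint_elems_iff_le:
  "x \<bottom>\<^sub>o y \<longleftrightarrow> (\<forall>p. p \<le> modulus x \<and> p \<le> modulus y \<longrightarrow> p \<le> 0)"
  unfolding disjoint_elems_iff by (meson inf_le1 inf_le2 le_infI order_trans)

lemma disjoint_elems_mono: "x \<bottom>\<^sub>o y \<Longrightarrow> modulus u \<le> modulus x \<Longrightarrow> u \<bottom>\<^sub>o y"
  unfolding disjoint_elems_iff_le by (meson order_trans)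

text \<open>The two hypotheses are used in turn: subtracting \<open>modulus x'\<close> from a common
  lower bound \<open>p\<close> leads to \<open>p \<le> modulus x'\<close> by the first, and then to
  \<open>p \<le> 0\<close> by the second.\<close>

lemma disjoint_elems_add:
  fixes x x' y :: 'a
  assumes "x \<bottom>\<^sub>o y" "x' \<bottom>\<^sub>o y"
  shows "x + x' \<bottom>\<^sub>o y"
  unfolding disjoint_elems_iff_le
proof (intro allI impI)
  fix p assume p: "p \<le> modulus (x + x') \<and> p \<le> modulus y"
  have "p - modulus x' \<le> modulus x"
    using p modulus_add_le[of x x'] by (auto simp: diff_le_eq intro: order_trans)
  moreover have "p - modulus x' \<le> modulus y"
    using p modulus_nonneg[of x'] by (metis add_mono add.right_neutral diff_le_eq)
  ultimately have "p - modulus x' \<le> 0"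
    using assms(1) by (auto simp: disjoint_elems_iff_le)
  then show "p \<le> 0" using p assms(2) by (auto simp: disjoint_elems_iff_le)
qed

lemma disjoint_elems_scaleR:
  fixes x y :: 'a
  assumes "x \<bottom>\<^sub>o y"
  shows "c *\<^sub>R x \<bottom>\<^sub>o y"
  unfolding disjoint_elems_iff_le
proof (intro allI impI)
  fix p assume p: "p \<le> modulus (c *\<^sub>R x) \<and> p \<le> modulus y"
  \<comment> \<open>The summand 1 keeps \<open>m\<close> invertible when \<open>c = 0\<close> and
    makes \<open>m *\<^sub>R modulus y\<close> dominate \<open>modulus y\<close>, so
    \<open>p\<close> can be rescaled against both moduli at once.\<close>
  define m where "m = \<bar>c\<bar> + 1"
  have m: "m > 0" "1 \<le> m" "\<bar>c\<bar> \<le> m" by (auto simp: m_def)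
  have "modulus (c *\<^sub>R x) \<le> m *\<^sub>R modulus x"
    using modulus_scaleR_le scaleR_right_mono[OF m(3) modulus_nonneg] by (rule order_trans)
  then have "p \<le> m *\<^sub>R modulus x" using p by (auto intro: order_trans)
  moreover have "p \<le> m *\<^sub>R modulus y"
    using p scaleR_right_mono[OF m(2) modulus_nonneg, of y] by (auto intro: order_trans)
  ultimately have "inverse m *\<^sub>R p \<le> inverse m *\<^sub>R m *\<^sub>R modulus x"
      "inverse m *\<^sub>R p \<le> inverse m *\<^sub>R m *\<^sub>R modulus y"
    using m by (auto intro!: scaleR_left_mono simp del: scaleR_scaleR)
  then have "inverse m *\<^sub>R p \<le> 0" using m assms by (auto simp: disjoint_elems_iff_le)
  then have "m *\<^sub>R inverse m *\<^sub>R p \<le> m *\<^sub>R 0" using m by (intro scaleR_left_mono) auto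
  then show "p \<le> 0" using m by simp
qed

section \<open>Disjoint complements in a vector lattice\<close>

lemma subspace_disjoint_compl: "subspace (disjoint_compl (M :: 'a set))"
proof (rule subspaceI)
  show "0 \<in> disjoint_compl M"
    using modulus_of_nonneg[of 0] by (auto simp: disjoint_compl_def disjoint_elems_iff_le)
qed (auto simp: disjoint_compl_def intro: disjoint_elems_add disjoint_elems_scaleR)

lemma modulus_in_disjoint_compl: "x \<in> disjoint_compl M \<Longrightarrow> modulus x \<in> disjoint_compl M"
  using modulus_of_nonneg[OF modulus_nonneg]
  by (auto simp: disjoint_compl_def intro: disjoint_elems_mono)

text \<open>Translation by \<open>a\<close> reduces the claim to positive elements, where the order
  is the order of moduli.\<close>

lemma order_convex_disjoint_compl:
  fixes M :: "'a set"
  assumes "a \<in> disjoint_compl M" "b \<in> disjoint_compl M" "a \<le> u" "u \<le> b"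
  shows "u \<in> disjoint_compl M"
proof -
  have "modulus (u - a) \<le> modulus (b - a)"
    using assms(3,4) by (subst (1 2) modulus_of_nonneg) auto
  moreover have "b - a \<in> disjoint_compl M"
    using assms subspace_disjoint_compl by (intro subspace_diff)
  ultimately have "u - a \<in> disjoint_compl M"
    by (auto simp: disjoint_compl_def intro: disjoint_elems_mono)
  from subspace_add[OF subspace_disjoint_compl this assms(1)] show ?thesis by simp
qed

lemma directed_on_disjoint_compl: "directed_on (disjoint_compl (M :: 'a set))"
  unfolding directed_on_def
proof (intro ballI)
  fix x y assume "x \<in> disjoint_compl M" "y \<in> disjoint_compl M"
  then have "modulus x + modulus y \<in> disjoint_compl M"
    by (intro subspace_add subspace_disjoint_compl modulus_in_disjoint_compl)
  moreover have "x \<le> modulus x + modulus y" "y \<le> modulus x + modulus y"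
    using add_mono[OF le_modulus[of x] modulus_nonneg[of y]]
      add_mono[OF modulus_nonneg[of x] le_modulus[of y]] by simp_all
  ultimately show "\<exists>z\<in>disjoint_compl M. x \<le> z \<and> y \<le> z" by blast
qed

lemma band_disjoint_compl: "band (disjoint_compl (M :: 'a set))"
  by (simp add: band_def subspace_disjoint_compl disjoint_compl_thrice)

end

lemma vector_lattice_on_UNIV_obtains:
  assumes "vector_lattice_on (UNIV :: 'a::ordered_real_vector set)"
  obtains meet join :: "'a::ordered_real_vector \<Rightarrow> 'a \<Rightarrow> 'a" where "real_vector_lattice meet join"
proof -
  define join :: "'a \<Rightarrow> 'a \<Rightarrow> 'a" where "join x y = (SOME s. isLub UNIV {x, y} s)" for x y
  define meet :: "'a \<Rightarrow> 'a \<Rightarrow> 'a" where "meet x y = (SOME s. isGlb UNIV {x, y} s)" for x y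
  have "isLub UNIV {x, y} (join x y)" "isGlb UNIV {x, y} (meet x y)" for x y
    using assms unfolding join_def meet_def vector_lattice_on_def by (auto intro: someI_ex)
  then have "real_vector_lattice meet join"
    by unfold_locales (auto simp: isLub_iff isGlb_iff)
  then show thesis by (rule that)
qed

section \<open>The smallest extension band\<close>

text \<open>Disjointness compares sets of upper bounds, and order density carries inclusions of such
  sets from the domain to the cover: an upper bound \<open>w\<close> there is replaced by its
  majorants \<open>i d\<close>.\<close>

lemma disjoint_elems_map_iff:
  fixes i :: "'a::ordered_real_vector \<Rightarrow> 'b::ordered_real_vector"
  assumes "vector_lattice_cover UNIV UNIV i"
  shows "i x \<bottom>\<^sub>o i y \<longleftrightarrow> x \<bottom>\<^sub>o y"
proof -
  interpret lattice_cover UNIV UNIV i using assms by unfold_locales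
  have ubs: "i u \<in> ubs UNIV {i a, - i a} \<longleftrightarrow> u \<in> ubs UNIV {a, - a}" for u a
    using map_le_iff[of a u] map_le_iff[of "- a" u] by (auto simp: ubs_UNIV_iff map_minus)
  have sub: "ubs UNIV {i b, - i b} \<subseteq> ubs UNIV {i a, - i a}"
    if *: "ubs UNIV {b, - b} \<subseteq> ubs UNIV {a, - a}" for a b
  proof
    fix w assume w: "w \<in> ubs UNIV {i b, - i b}"
    have "i d \<in> ubs UNIV {i a, - i a}" if "w \<le> i d" for d
    proof -
      have "i d \<in> ubs UNIV {i b, - i b}"
        using w that by (auto simp: ubs_UNIV_iff intro: order_trans)
      then show ?thesis using ubs * by blast
    qed
    then show "w \<in> ubs UNIV {i a, - i a}"
      using le_if_le_majorants[of w] by (auto simp: ubs_UNIV_iff)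
  qed
  have "ubs UNIV {i a, - i a} = ubs UNIV {i b, - i b} \<longleftrightarrow> ubs UNIV {a, - a} = ubs UNIV {b, - b}" for a b
    using sub[of a b] sub[of b a] ubs by (metis subsetI subset_antisym order_refl)
  from this[of "x + y" "x - y"] show ?thesis
    by (simp add: disjoint_elems_def map_add map_diff)
qed

text \<open>Every extension band contains \<open>i\<close> B\<open>and, being a band, its double
  complement. That the latter meets the image of\<close>i\<open>only in\<close>i \<open>B\<close>
  follows because \<open>i\<close> preserves and reflects disjointness.\<close>

lemma smallest_extension_band_eq:
  fixes i :: "'a::ordered_real_vector \<Rightarrow> 'b::ordered_real_vector"
  assumes "vector_lattice_cover UNIV UNIV i" "band B"
  shows "smallest_extension_band i B = disjoint_compl (disjoint_compl (i ` B))" (is "_ = ?J")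
    and "extension_band i B (disjoint_compl (disjoint_compl (i ` B)))"
proof -
  obtain meet join :: "'b \<Rightarrow> 'b \<Rightarrow> 'b" where "real_vector_lattice meet join"
    using assms(1) vector_lattice_on_UNIV_obtains unfolding vector_lattice_cover_def by blast
  then interpret real_vector_lattice meet join .
  have "i ` disjoint_compl B \<subseteq> disjoint_compl (i ` B)"
    using disjoint_elems_map_iff[OF assms(1)] by (auto simp: disjoint_compl_def)
  \<comment> \<open>For elements \<open>i x\<close> of \<open>?J\<close>, reflecting disjointness
    now puts \<open>x\<close> into the double complement of \<open>B\<close>, which is
    \<open>B\<close>.\<close>
  then have "?J \<subseteq> disjoint_compl (i ` disjoint_compl B)"
    by (rule disjoint_compl_antimono)
  then have "x \<in> disjoint_compl (disjoint_compl B)" if "i x \<in> ?J" for x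
    using that disjoint_elems_map_iff[OF assms(1)] unfolding disjoint_compl_def by blast
  then have "{x. i x \<in> ?J} = B"
    using subset_disjoint_compl_twice[of "i ` B"] assms(2) by (auto simp: band_def)
  then show ext: "extension_band i B ?J"
    by (auto simp: extension_band_def band_disjoint_compl)
  have "?J \<subseteq> J" if "extension_band i B J" for J
  proof -
    have "i ` B \<subseteq> J" "disjoint_compl (disjoint_compl J) = J"
      using that by (auto simp: extension_band_def band_def)
    then show ?thesis by (metis disjoint_compl_antimono)
  qed
  then show "smallest_extension_band i B = ?J"
    using ext unfolding smallest_extension_band_def by blast
qed

section \<open>Order convex subspaces\<close>

text \<open>Ambient suprema and infima of pairs stay in \<open>J\<close>, being squeezed between
  elements of \<open>J\<close>; the lower bound comes from directedness applied to
  \<open>- x\<close> and \<open>- y\<close>.\<close>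

lemma vector_lattice_on_order_convex:
  fixes J :: "'a::ordered_real_vector set"
  assumes lat: "vector_lattice_on (UNIV :: 'a set)"
    and J: "subspace J" "directed_on J"
    and convex: "\<And>a b u. a \<in> J \<Longrightarrow> b \<in> J \<Longrightarrow> a \<le> u \<Longrightarrow> u \<le> b \<Longrightarrow> u \<in> J"
  shows "vector_lattice_on J"
  unfolding vector_lattice_on_def
proof (intro conjI ballI)
  fix x y assume xy: "x \<in> J" "y \<in> J"
  obtain b where b: "b \<in> J" "x \<le> b" "y \<le> b" using J(2) xy by (auto simp: directed_on_def)
  obtain a where a: "a \<in> J" "- x \<le> a" "- y \<le> a"
    using J xy by (meson directed_on_def subspace_neg)
  have a': "- a \<in> J" "- a \<le> x" "- a \<le> y"
    using a J(1) by (auto simp: subspace_neg minus_le_iff)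
  obtain s t where s: "isLub UNIV {x, y} s" and t: "isGlb UNIV {x, y} t"
    using lat unfolding vector_lattice_on_def by blast
  have "s \<in> J" using s xy b convex[of x b s] by (auto simp: isLub_iff)
  then show "\<exists>s. isLub J {x, y} s" using s by (auto simp: isLub_iff)
  have "t \<in> J" using t xy a' convex[of "- a" x t] by (auto simp: isGlb_iff)
  then show "\<exists>t. isGlb J {x, y} t" using t by (auto simp: isGlb_iff)
qed fact

text \<open>The ambient supremum lies between any element of the nonempty set \<open>S\<close> and
  an upper bound in \<open>J\<close>.\<close>

lemma dedekind_complete_on_order_convex:
  fixes J :: "'a::ordered_real_vector set"
  assumes compl: "dedekind_complete_on (UNIV :: 'a set)"
    and convex: "\<And>a b u. a \<in> J \<Longrightarrow> b \<in> J \<Longrightarrow> a \<le> u \<Longrightarrow> u \<le> b \<Longrightarrow> u \<in> J"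
  shows "dedekind_complete_on J"
  unfolding dedekind_complete_on_def
proof (intro allI impI)
  fix S assume S: "S \<subseteq> J" "S \<noteq> {}" "\<exists>u. isUb J S u"
  then obtain u a where u: "u \<in> J" "\<forall>x\<in>S. x \<le> u" and a: "a \<in> S"
    by (auto simp: isUb_def setle_def)
  then have "isUb UNIV S u" by (auto simp: isUb_def setle_def)
  then obtain s where s: "isLub UNIV S s"
    using compl S(2) unfolding dedekind_complete_on_def by blast
  have "s \<in> J" using s u a S(1) convex[of a u s] by (auto simp: isLub_iff)
  then show "\<exists>s. isLub J S s" using s by (auto simp: isLub_iff)
qed

lemma order_dense_in_order_convex:
  fixes i :: "'a::ordered_real_vector \<Rightarrow> 'b::ordered_real_vector"
  assumes arch: "archimedean_on (UNIV :: 'a set)"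
    and perv: "pervasive_wrt UNIV UNIV i"
    and J: "subspace J" "directed_on J"
    and convex: "\<And>a b u. a \<in> J \<Longrightarrow> b \<in> J \<Longrightarrow> a \<le> u \<Longrightarrow> u \<le> b \<Longrightarrow> u \<in> J"
    and B: "\<And>x. x \<in> B \<longleftrightarrow> i x \<in> J"
    and maj: "majorizing_in (i ` B) J"
  shows "order_dense_in (i ` B) J"
proof -
  interpret lattice_cover UNIV UNIV i
    using perv by unfold_locales (simp add: pervasive_wrt_def)
  have "w \<le> z" if zw: "z \<in> J" "w \<in> J" and lower: "\<And>d. d \<in> B \<Longrightarrow> z \<le> i d \<Longrightarrow> w \<le> i d" for z w
  proof -
    obtain s where s: "isLub UNIV {w, z} s"
      using cover by (auto simp: vector_lattice_cover_def vector_lattice_on_def)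
    obtain t where "t \<in> J" "w \<le> t" "z \<le> t" using zw J(2) by (auto simp: directed_on_def)
    then have sJ: "s \<in> J" using s zw convex[of w t s] by (auto simp: isLub_iff)
    have lower_s: "s \<le> i d" if "d \<in> B" "z \<le> i d" for d
      using s that lower by (auto simp: isLub_iff)
    have "s = z"
    proof (rule ccontr)
      assume "s \<noteq> z"
      then have "0 \<le> s - z" "s - z \<noteq> 0" using s by (auto simp: isLub_iff)
      then obtain x where x: "0 < i x" "i x \<le> s - z"
        using perv unfolding pervasive_wrt_def by blast
      have "i x \<in> J"
        using convex[of 0 "s - z" "i x"] x sJ zw J(1) by (auto simp: subspace_0 subspace_diff)
      then have step: "d - x \<in> B \<and> z \<le> i (d - x)" if "d \<in> B" "z \<le> i d" for d
        using lower_s[OF that] x(2) that(1) J(1) unfolding B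
        by (auto simp: map_diff subspace_diff algebra_simps intro: order_trans)
      obtain d where d: "d \<in> B" "z \<le> i d" using maj zw by (auto simp: majorizing_in_def)
      \<comment> \<open>Majorizing \<open>- z\<close> bounds \<open>z\<close> from below by
        \<open>- i e\<close>, so that all multiples of \<open>x\<close> stay below the single
        element \<open>d + e\<close>.\<close>
      obtain e where e: "e \<in> B" "- z \<le> i e"
        using maj subspace_neg[OF J(1) zw(1)] by (auto simp: majorizing_in_def)
      have iter: "d - real n *\<^sub>R x \<in> B \<and> z \<le> i (d - real n *\<^sub>R x)" for n
      proof (induction n)
        case (Suc n)
        then show ?case using step[of "d - real n *\<^sub>R x"] by (simp add: algebra_simps)
      qed (use d in simp)
      have "real n *\<^sub>R x \<le> d + e" for n
      proof -
        have "- i e \<le> i (d - real n *\<^sub>R x)"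
          using iter[of n] e(2) by (meson minus_le_iff order_trans)
        then have "i (real n *\<^sub>R x) \<le> i (d + e)"
          by (simp add: map_diff map_add algebra_simps)
        then show ?thesis by (simp add: map_le_iff)
      qed
      then have "x \<le> 0" using arch unfolding archimedean_on_def by blast
      then show False using x(1) map_pos_iff[of x] by auto
    qed
    then show ?thesis using s by (auto simp: isLub_iff)
  qed
  then show ?thesis
    using maj by (auto simp: order_dense_in_def majorizing_in_def isGlb_iff)
qed

text \<open>Pervasiveness is assumed through an arbitrary cover \<open>(Y, j)\<close>. For
  \<open>B\<close> it is concluded both for the completion and for every cover in a further
  arbitrary type.\<close>

theorem corollary32:
  fixes i :: "'x::ordered_real_vector \<Rightarrow> 'd::ordered_real_vector"
    and Y :: "'y::ordered_real_vector set" and j :: "'x \<Rightarrow> 'y"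
    and B :: "'x set" and Bhat :: "'d set"
  assumes "archimedean_on (UNIV :: 'x set)"
    and "pervasive_wrt (UNIV :: 'x set) Y j"
    and "dedekind_completion (UNIV :: 'x set) (UNIV :: 'd set) i"
    and "band B"
    and "Bhat = smallest_extension_band i B"
    and "majorizing_in (i ` B) Bhat"
  shows "dedekind_completion B Bhat i \<and>
    pervasive_wrt B Bhat i \<and>
    (\<forall>(Z :: 'z::ordered_real_vector set) k. vector_lattice_cover B Z k \<longrightarrow> pervasive_wrt B Z k)"
proof -
  have cov: "vector_lattice_cover UNIV UNIV i" and compl: "dedekind_complete_on (UNIV :: 'd set)"
    using assms(3) by (auto simp: dedekind_completion_def)
  have lat: "vector_lattice_on (UNIV :: 'd set)"
    using cov by (simp add: vector_lattice_cover_def)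
  have perv: "pervasive_wrt UNIV UNIV i"
    using assms(2) cov by (rule pervasive_wrt_cover_indep)
  interpret lattice_cover UNIV UNIV i using cov by unfold_locales
  obtain meet join :: "'d \<Rightarrow> 'd \<Rightarrow> 'd" where "real_vector_lattice meet join"
    using lat vector_lattice_on_UNIV_obtains by blast
  then interpret real_vector_lattice meet join .
  have Bhat: "Bhat = disjoint_compl (disjoint_compl (i ` B))"
    using smallest_extension_band_eq(1)[OF cov assms(4)] assms(5) by simp
  have B: "x \<in> B \<longleftrightarrow> i x \<in> Bhat" for x
    using smallest_extension_band_eq(2)[OF cov assms(4)] by (auto simp: extension_band_def Bhat)
  have sub: "subspace Bhat" and dir: "directed_on Bhat"
    using subspace_disjoint_compl directed_on_disjoint_compl by (auto simp: Bhat)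
  have convex: "u \<in> Bhat" if "a \<in> Bhat" "b \<in> Bhat" "a \<le> u" "u \<le> b" for a b u
    using that order_convex_disjoint_compl unfolding Bhat by blast
  have "order_dense_in (i ` B) Bhat"
    by (rule order_dense_in_order_convex[OF assms(1) perv sub dir convex B assms(6)])
  moreover have "vector_lattice_on Bhat"
    by (rule vector_lattice_on_order_convex[OF lat sub dir convex])
  ultimately have cover_B: "vector_lattice_cover B Bhat i"
    using cov assms(4)
    by (auto simp: vector_lattice_cover_def linear_on_subspace_def bipositive_on_def band_def)
  have "directed_on B"
    unfolding directed_on_def
  proof (intro ballI)
    fix x y assume "x \<in> B" "y \<in> B"
    then obtain t where t: "t \<in> Bhat" "i x \<le> t" "i y \<le> t"
      using dir B unfolding directed_on_def by blast
    \<comment> \<open>Directedness of \<open>Bhat\<close> descends to \<open>B\<close> because the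
      image of \<open>B\<close> is majorizing.\<close>
    then obtain z where "z \<in> B" "t \<le> i z" using assms(6) by (auto simp: majorizing_in_def)
    then have "z \<in> B" "i x \<le> i z" "i y \<le> i z" using t by (auto intro: order_trans)
    then show "\<exists>z\<in>B. x \<le> z \<and> y \<le> z" using map_le_iff by auto
  qed
  moreover have "dedekind_complete_on Bhat"
    by (rule dedekind_complete_on_order_convex[OF compl convex])
  moreover have "archimedean_on B" using assms(1) unfolding archimedean_on_def by blast
  ultimately have dedekind: "dedekind_completion B Bhat i"
    using cover_B by (simp add: dedekind_completion_def)
  have "\<exists>x\<in>B. 0 < i x \<and> i x \<le> y" if y: "y \<in> Bhat" "0 \<le> y" "y \<noteq> 0" for y
  proof -
    obtain x where x: "0 < i x" "i x \<le> y" using perv y unfolding pervasive_wrt_def by blast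
    \<comment> \<open>Order convexity moves the witness from the whole space into
      \<open>B\<close>.\<close>
    then have "i x \<in> Bhat" using convex[of 0 y "i x"] subspace_0[OF sub] y by auto
    then show ?thesis using x B by blast
  qed
  then have "pervasive_wrt B Bhat i" using cover_B by (auto simp: pervasive_wrt_def)
  then show ?thesis using dedekind pervasive_wrt_cover_indep by blast
qed

end
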